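(* Let $\mathbf x$ be a $1$-generic Turing degree and let $\{C_i=A_i\setminus B_i\}_{i\in\omega}$ be a computable sequence of differences of c.e. sets. If there is an $\mathbf x$-computable selector function for $\{C_i\}_{i\in\omega}$, then there is a computable selector function for $\{C_i\}_{i\in\omega}$. Likewise, if there is an $\mathbf x$-computable weak selector function for $\{C_i\}_{i\in\omega}$, then there is a computable weak selector function for $\{C_i\}_{i\in\omega}$.
   Context: A computable sequence of differences of c.e. sets $\{C_i\}_{i\in\omega}$ is given by two uniformly c.e. sequences $\{A_i\}_{i\in\omega}$, $\{B_i\}_{i\in\omega}$ of subsets of $\omega$, with $C_i=A_i\setminus B_i$. A selector function for $\{C_i\}_{i\in\omega}$ is any function $f:\omega\to\omega$ such that $f(i)\in C_i$ for every $i\in\omega$. Let $\{D_n\}_{n\in\omega}$ be the canonical numbering of all finite subsets of $\omega$, $n=\sum_{x\in D_n}2^x$. A weak selector function for $\{C_i=A_i\setminus B_i\}_{i\in\omega}$ is a selector function for the sequence $\{\widehat C_i=\widehat A_i\setminus\widehat B_i\}_{i\in\omega}$, where $\widehat A_i=\{n\mid D_n\subseteq A_i\}$ and $\widehat B_i=\{n\mid D_n\subseteq B_i\}$. A Turing degree $\mathbf x$ is $1$-generic if it contains a set $X$ such that for every c.e. set $W\subseteq 2^{<\omega}$ there is a finite initial segment $\sigma\subset X$ with $\sigma\in W$ or $(\forall\tau\supseteq\sigma)[\tau\notin W]$. *)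

theory Defs
  imports "HOL-Library.Nat_Bijection" "HOL-Library.Sublist"
begin

(* Programs for the partial recursive functions relative to a set of natural numbers.
   Query is the characteristic function of that set. *)
datatype prog =
    Zero
  | Succ
  | Proj nat
  | Query
  | Comp prog "prog list"
  | PrimRec prog prog
  | Mu prog

(* "runs X p xs y": with oracle X, program p halts on the arguments xs with value y.
   Programs carry no arity; where the number of arguments does not fit, p is undefined. *)
inductive runs :: "nat set \<Rightarrow> prog \<Rightarrow> nat list \<Rightarrow> nat \<Rightarrow> bool" for X :: "nat set" where
  runs_Zero: "runs X Zero xs 0"
| runs_Succ: "runs X Succ [n] (Suc n)"
| runs_Proj: "i < length xs \<Longrightarrow> runs X (Proj i) xs (xs ! i)"
| runs_Query: "runs X Query [n] (of_bool (n \<in> X))"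
| runs_Comp: "list_all2 (\<lambda>q y. runs X q xs y) qs ys \<Longrightarrow> runs X p ys z \<Longrightarrow>
    runs X (Comp p qs) xs z"
| runs_PrimRec_0: "runs X p xs y \<Longrightarrow> runs X (PrimRec p q) (0 # xs) y"
| runs_PrimRec_Suc: "runs X (PrimRec p q) (n # xs) y \<Longrightarrow> runs X q (n # y # xs) z \<Longrightarrow>
    runs X (PrimRec p q) (Suc n # xs) z"
| runs_Mu: "runs X p (n # xs) 0 \<Longrightarrow> \<forall>m<n. \<exists>k>0. runs X p (m # xs) k \<Longrightarrow>
    runs X (Mu p) xs n"

inductive_cases runs_ZeroE: "runs X Zero xs z"
inductive_cases runs_SuccE: "runs X Succ xs z"
inductive_cases runs_ProjE: "runs X (Proj i) xs z"
inductive_cases runs_QueryE: "runs X Query xs z"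
inductive_cases runs_CompE: "runs X (Comp p qs) xs z"
inductive_cases runs_PrimRec_0E: "runs X (PrimRec p q) (0 # xs) z"
inductive_cases runs_PrimRec_SucE: "runs X (PrimRec p q) (Suc n # xs) z"
inductive_cases runs_MuE: "runs X (Mu p) xs z"

lemma runs_deterministic: "runs X p xs y \<Longrightarrow> runs X p xs z \<Longrightarrow> y = z"
proof (induction arbitrary: z rule: runs.induct)
  case (runs_Zero xs)
  then show ?case by (rule runs_ZeroE) simp
next
  case (runs_Succ n)
  then show ?case by (rule runs_SuccE) simp
next
  case (runs_Proj i xs)
  from runs_Proj.prems show ?case by (rule runs_ProjE) simp
next
  case (runs_Query n)
  then show ?case by (rule runs_QueryE) simp
next
  case (runs_Comp xs qs ys p y)
  from runs_Comp.prems obtain ys' where ys': "list_all2 (\<lambda>q y. runs X q xs y) qs ys'"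
    "runs X p ys' z"
    by (rule runs_CompE)
  have "ys = ys'"
  proof (rule nth_equalityI)
    show "length ys = length ys'"
      using list_all2_lengthD[OF runs_Comp.IH(1)] list_all2_lengthD[OF ys'(1)] by (rule trans[OF sym])
    fix i
    assume "i < length ys"
    then have i: "i < length qs" using list_all2_lengthD[OF runs_Comp.IH(1)] by simp
    have "runs X (qs ! i) xs (ys' ! i)" using list_all2_nthD[OF ys'(1) i] .
    then show "ys ! i = ys' ! i" using list_all2_nthD[OF runs_Comp.IH(1) i] by blast
  qed
  then show ?case using runs_Comp.IH(2) ys'(2) by blast
next
  case (runs_PrimRec_0 p xs y q)
  from runs_PrimRec_0.prems have "runs X p xs z" by (rule runs_PrimRec_0E)
  then show ?case by (rule runs_PrimRec_0.IH)
next
  case (runs_PrimRec_Suc p q n xs y w)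
  from runs_PrimRec_Suc.prems obtain y' where y': "runs X (PrimRec p q) (n # xs) y'"
    "runs X q (n # y' # xs) z"
    by (rule runs_PrimRec_SucE)
  have "y = y'" using y'(1) by (rule runs_PrimRec_Suc.IH)
  then show ?case using y'(2) runs_PrimRec_Suc.IH(2) by blast
next
  case (runs_Mu p n xs)
  from runs_Mu.prems have z: "runs X p (z # xs) 0" "\<forall>m<z. \<exists>k>0. runs X p (m # xs) k"
    by (auto elim: runs_MuE)
  show ?case
  proof (rule linorder_cases[of n z])
    assume "n < z"
    then obtain k where "k > 0" "runs X p (n # xs) k" using z(2) by blast
    then have "0 = k" using runs_Mu.IH(1) by blast
    then show ?thesis using \<open>k > 0\<close> by simp
  next
    assume "z < n"
    then obtain k where "k > 0" "\<And>w. runs X p (z # xs) w \<Longrightarrow> k = w" using runs_Mu.IH(2) by blast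
    then have "k = 0" using z(1) by blast
    then show ?thesis using \<open>k > 0\<close> by simp
  qed
qed

fun query_free :: "prog \<Rightarrow> bool" where
  "query_free Query \<longleftrightarrow> False"
| "query_free (Comp p qs) \<longleftrightarrow> query_free p \<and> (\<forall>q\<in>set qs. query_free q)"
| "query_free (PrimRec p q) \<longleftrightarrow> query_free p \<and> query_free q"
| "query_free (Mu p) \<longleftrightarrow> query_free p"
| "query_free _ \<longleftrightarrow> True"

lemma query_free_runs: "runs X p xs y \<Longrightarrow> query_free p \<Longrightarrow> runs Y p xs y"
proof (induction rule: runs.induct)
  case (runs_Comp xs qs ys p y)
  have "list_all2 (\<lambda>q y. runs Y q xs y) qs ys"
    using runs_Comp.IH(1) runs_Comp.prems by (simp add: list_all2_conv_all_nth)
  moreover have "runs Y p ys y" using runs_Comp.IH(2) runs_Comp.prems by simp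
  ultimately show ?case by (rule runs.runs_Comp)
next
  case (runs_PrimRec_Suc p q n xs y z)
  have "runs Y (PrimRec p q) (n # xs) y" "runs Y q (n # y # xs) z"
    using runs_PrimRec_Suc.IH runs_PrimRec_Suc.prems by simp_all
  then show ?case by (rule runs.runs_PrimRec_Suc)
next
  case (runs_Mu p n xs)
  have "\<forall>m<n. \<exists>k>0. runs Y p (m # xs) k" "runs Y p (n # xs) 0"
    using runs_Mu.IH runs_Mu.prems by auto
  then show ?case by (intro runs.runs_Mu)
qed (simp_all add: runs.runs_Zero runs.runs_Succ runs.runs_Proj runs.runs_PrimRec_0)

definition computable_in :: "nat set \<Rightarrow> (nat \<Rightarrow> nat) \<Rightarrow> bool" where
  "computable_in X f \<longleftrightarrow> (\<exists>p. \<forall>n. runs X p [n] (f n))"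

(* The set given to a program without queries is irrelevant, see query_free_runs. *)
definition computable :: "(nat \<Rightarrow> nat) \<Rightarrow> bool" where
  "computable f \<longleftrightarrow> (\<exists>p. query_free p \<and> (\<forall>n. runs {} p [n] (f n)))"

definition ce :: "nat set \<Rightarrow> bool" where
  "ce S \<longleftrightarrow> (\<exists>p. query_free p \<and> S = {n. \<exists>y. runs {} p [n] y})"

definition uniformly_ce :: "(nat \<Rightarrow> nat set) \<Rightarrow> bool" where
  "uniformly_ce A \<longleftrightarrow> (\<exists>p. query_free p \<and> (\<forall>i. A i = {n. \<exists>y. runs {} p [i, n] y}))"

definition turing_reducible :: "nat set \<Rightarrow> nat set \<Rightarrow> bool" where
  "turing_reducible Y X \<longleftrightarrow> computable_in X (\<lambda>n. of_bool (n \<in> Y))"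

definition turing_equiv :: "(nat set \<times> nat set) set" where
  "turing_equiv = {(X, Y). turing_reducible X Y \<and> turing_reducible Y X}"

primrec subst_query :: "prog \<Rightarrow> prog \<Rightarrow> prog" where
  "subst_query r Zero = Zero"
| "subst_query r Succ = Succ"
| "subst_query r (Proj i) = Proj i"
| "subst_query r Query = r"
| "subst_query r (Comp p qs) = Comp (subst_query r p) (map (subst_query r) qs)"
| "subst_query r (PrimRec p q) = PrimRec (subst_query r p) (subst_query r q)"
| "subst_query r (Mu p) = Mu (subst_query r p)"

lemma runs_subst_query:
  assumes "\<And>n. runs X r [n] (of_bool (n \<in> Y))"
  shows "runs Y p xs y \<Longrightarrow> runs X (subst_query r p) xs y"
proof (induction rule: runs.induct)
  case (runs_Comp xs qs ys p y)
  have "list_all2 (\<lambda>q y. runs X q xs y) (map (subst_query r) qs) ys"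
    using runs_Comp.IH(1) by (simp add: list_all2_conv_all_nth)
  then show ?case using runs_Comp.IH(2) by (simp add: runs.runs_Comp)
next
  case (runs_PrimRec_Suc p q n xs y z)
  have "runs X (subst_query r (PrimRec p q)) (n # xs) y" "runs X (subst_query r q) (n # y # xs) z"
    using runs_PrimRec_Suc.IH by simp_all
  then show ?case using runs.runs_PrimRec_Suc by simp
next
  case (runs_Mu p n xs)
  have "\<forall>m<n. \<exists>k>0. runs X (subst_query r p) (m # xs) k" using runs_Mu.IH(2) by blast
  then show ?case using runs_Mu.IH(1) by (simp add: runs.runs_Mu)
qed (simp_all add: assms runs.runs_Zero runs.runs_Succ runs.runs_Proj runs.runs_PrimRec_0)

lemma computable_in_trans:
  "computable_in Y f \<Longrightarrow> turing_reducible Y X \<Longrightarrow> computable_in X f"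
  unfolding computable_in_def turing_reducible_def using runs_subst_query by blast

lemma equiv_turing_equiv: "equiv UNIV turing_equiv"
proof (rule equivI)
  have "turing_reducible X X" for X
    unfolding turing_reducible_def computable_in_def by (intro exI[of _ Query] allI runs_Query)
  then show "refl turing_equiv"
    by (simp add: refl_on_def turing_equiv_def)
  show "sym turing_equiv"
    by (simp add: sym_def turing_equiv_def)
  have "turing_reducible X Z" if "turing_reducible X Y" "turing_reducible Y Z" for X Y Z
    using that computable_in_trans unfolding turing_reducible_def by blast
  then show "trans turing_equiv"
    unfolding trans_def turing_equiv_def by blast
qed simp

definition turing_degrees :: "nat set set set" where
  "turing_degrees = UNIV // turing_equiv"

definition degree_computable :: "nat set set \<Rightarrow> (nat \<Rightarrow> nat) \<Rightarrow> bool" where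
  "degree_computable x f \<longleftrightarrow> (\<exists>X\<in>x. computable_in X f)"

(* Bijective base-2 numeration, first bit least significant. *)
fun string_code :: "bool list \<Rightarrow> nat" where
  "string_code [] = 0"
| "string_code (b # s) = 2 * string_code s + (if b then 2 else 1)"

lemma bij_string_code: "bij string_code"
proof (rule bijI)
  show "inj string_code"
  proof (rule injI)
    fix s t show "string_code s = string_code t \<Longrightarrow> s = t"
    proof (induction s arbitrary: t)
      case Nil
      then show ?case by (cases t) (auto split: if_splits)
    next
      case (Cons b s)
      then obtain c t' where t: "t = c # t'" by (cases t) (auto split: if_splits)
      have *: "2 * string_code s + (if b then 2 else 1) = 2 * string_code t' + (if c then 2 else 1)"
        using Cons.prems unfolding t by simp
      have "b = c \<and> string_code s = string_code t'"
        using * by (cases b; cases c; simp; presburger)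
      then show ?case using Cons.IH t by simp
    qed
  qed
  have "\<exists>s. string_code s = n" for n
  proof (induction n rule: less_induct)
    case (less n)
    show ?case
    proof (cases "n = 0")
      case True
      then show ?thesis by (intro exI[of _ "[]"]) simp
    next
      case False
      then have "(n - 1) div 2 < n" by linarith
      then obtain s where "string_code s = (n - 1) div 2" using less by blast
      moreover have "2 * ((n - 1) div 2) + (if even n then 2 else 1) = n"
        using False by presburger
      ultimately have "string_code (even n # s) = n" by simp
      then show ?thesis ..
    qed
  qed
  then show "surj string_code" by (metis surjI)
qed

definition ce_strings :: "bool list set \<Rightarrow> bool" where
  "ce_strings W \<longleftrightarrow> ce (string_code ` W)"

definition initial_segment :: "bool list \<Rightarrow> nat set \<Rightarrow> bool" where
  "initial_segment \<sigma> X \<longleftrightarrow> (\<forall>k<length \<sigma>. \<sigma> ! k \<longleftrightarrow> k \<in> X)"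

definition one_generic :: "nat set \<Rightarrow> bool" where
  "one_generic X \<longleftrightarrow> (\<forall>W. ce_strings W \<longrightarrow>
    (\<exists>\<sigma>. initial_segment \<sigma> X \<and> (\<sigma> \<in> W \<or> (\<forall>\<tau>. prefix \<sigma> \<tau> \<longrightarrow> \<tau> \<notin> W))))"

definition one_generic_degree :: "nat set set \<Rightarrow> bool" where
  "one_generic_degree x \<longleftrightarrow> x \<in> turing_degrees \<and> (\<exists>X\<in>x. one_generic X)"

definition selector :: "(nat \<Rightarrow> nat set) \<Rightarrow> (nat \<Rightarrow> nat) \<Rightarrow> bool" where
  "selector C f \<longleftrightarrow> (\<forall>i. f i \<in> C i)"

(* The canonical numbering of the finite sets is set_decode. *)
lemma set_decode_canonical: "finite (set_decode n) \<and> n = (\<Sum>x\<in>set_decode n. 2 ^ x)"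
  using set_decode_inverse[of n] by (simp add: set_encode_def)

definition finite_subset_codes :: "nat set \<Rightarrow> nat set" where
  "finite_subset_codes S = {n. set_decode n \<subseteq> S}"

(* A property of the pair (A, B), not only of the differences A i - B i. *)
definition weak_selector :: "(nat \<Rightarrow> nat set) \<Rightarrow> (nat \<Rightarrow> nat set) \<Rightarrow> (nat \<Rightarrow> nat) \<Rightarrow> bool" where
  "weak_selector A B f \<longleftrightarrow>
    selector (\<lambda>i. finite_subset_codes (A i) - finite_subset_codes (B i)) f"

end

theory Submission
  imports Defs "HOL.Filter"
begin

text \<open>Let \<open>X\<close> be 1-generic and let \<open>p\<close> compute a selector from \<open>X\<close>. The set \<open>W\<close> of the strings
  \<open>\<sigma>\<close> for which \<open>p\<close> with oracle \<open>\<sigma>\<close> yields on some argument \<open>i\<close> a value that is enumerated into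
  \<open>B i\<close> is c.e., and no initial segment of \<open>X\<close> is in \<open>W\<close>. By genericity some initial segment \<open>\<sigma>\<close>
  of \<open>X\<close> has no extension in \<open>W\<close>. A computable selector looks for an extension of \<open>\<sigma>\<close> with which
  \<open>p\<close> yields on \<open>i\<close> a value enumerated into \<open>A i\<close>: a search that ends, since \<open>X\<close> provides one, and
  whose result is not in \<open>B i\<close>. Weak selectors are the selectors for other c.e. sequences.

  All this is made effective without a universal machine: for each fixed program, evaluation with
  the code of a string as oracle and as bound on the searches is a total recursive function.\<close>

section \<open>Total recursive functions on lists of a fixed length\<close>

text \<open>Programs carry no arity, so the length is fixed from outside and values on lists of
  other lengths are unconstrained. Functions of the whole list let the closure rules apply directly
  to terms in \<open>xs ! i\<close>.\<close>

definition recursive :: "nat \<Rightarrow> (nat list \<Rightarrow> nat) \<Rightarrow> bool" where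
  "recursive k F \<longleftrightarrow> (\<exists>q. query_free q \<and> (\<forall>xs. length xs = k \<longrightarrow> runs {} q xs (F xs)))"

abbreviation decidable :: "nat \<Rightarrow> (nat list \<Rightarrow> bool) \<Rightarrow> bool" where
  "decidable k P \<equiv> recursive k (\<lambda>xs. of_bool (P xs))"

lemma recursive_cong:
  assumes "recursive k F" "\<And>xs. length xs = k \<Longrightarrow> F xs = G xs"
  shows "recursive k G"
  using assms by (fastforce simp: recursive_def)

lemma recursive_proj: "i < k \<Longrightarrow> recursive k (\<lambda>xs. xs ! i)"
  unfolding recursive_def by (rule exI[of _ "Proj i"]) (auto intro: runs_Proj)

lemma recursive_comp:
  assumes "recursive m F" "length Gs = m" "\<And>G. G \<in> set Gs \<Longrightarrow> recursive k G"
  shows "recursive k (\<lambda>xs. F (map (\<lambda>G. G xs) Gs))"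
proof -
  obtain p where p: "query_free p" "\<And>xs. length xs = m \<Longrightarrow> runs {} p xs (F xs)"
    using assms(1) by (auto simp: recursive_def)
  obtain r where r: "\<And>G. G \<in> set Gs \<Longrightarrow> query_free (r G) \<and>
      (\<forall>xs. length xs = k \<longrightarrow> runs {} (r G) xs (G xs))"
    using assms(3) unfolding recursive_def by metis
  have "runs {} (Comp p (map r Gs)) xs (F (map (\<lambda>G. G xs) Gs))" if "length xs = k" for xs
    using r that assms(2)
    by (intro runs_Comp[where ys = "map (\<lambda>G. G xs) Gs"] p) (auto simp: list_all2_conv_all_nth)
  then show ?thesis
    unfolding recursive_def using p(1) r by (intro exI[of _ "Comp p (map r Gs)"]) auto
qed

lemma recursive_Suc:
  assumes "recursive k F"
  shows "recursive k (\<lambda>xs. Suc (F xs))"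
proof -
  have "recursive 1 (\<lambda>xs. Suc (xs ! 0))"
    unfolding recursive_def
    by (rule exI[of _ Succ]) (auto simp: length_Suc_conv intro: runs_Succ)
  from recursive_comp[OF this, of "[F]"] assms show ?thesis by simp
qed

lemma recursive_const: "recursive k (\<lambda>xs. n)"
proof (induction n)
  case 0
  show ?case unfolding recursive_def by (rule exI[of _ Zero]) (auto intro: runs_Zero)
qed (rule recursive_Suc)

text \<open>Composition with the last \<open>k\<close> projections. Recursion and minimization put
  new variables at the head of the list, so the parameters have to be shifted.\<close>

lemma recursive_drop:
  assumes "recursive k F"
  shows "recursive (k + m) (\<lambda>xs. F (drop m xs))"
proof -
  have "recursive (k + m) (\<lambda>xs. F (map (\<lambda>G. G xs) (map (\<lambda>i xs. xs ! (m + i)) [0..<k])))"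
    using assms by (rule recursive_comp) (auto intro: recursive_proj)
  then show ?thesis
  proof (rule recursive_cong)
    fix xs :: "nat list" assume "length xs = k + m"
    then have "map (\<lambda>G. G xs) (map (\<lambda>i xs. xs ! (m + i)) [0..<k]) = drop m xs"
      by (intro nth_equalityI) auto
    then show "F (map (\<lambda>G. G xs) (map (\<lambda>i xs. xs ! (m + i)) [0..<k])) = F (drop m xs)"
      by (rule arg_cong)
  qed
qed

lemma recursive_drop1: "recursive k F \<Longrightarrow> recursive (Suc k) (\<lambda>xs. F (drop 1 xs))"
  using recursive_drop[of k F 1] by simp

lemma recursive_drop2: "recursive k F \<Longrightarrow> recursive (Suc (Suc k)) (\<lambda>xs. F (drop 2 xs))"
  using recursive_drop[of k F 2] by simp

lemma recursive_rec_nat: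
  assumes "recursive k N" "recursive k F"
    and "recursive (Suc (Suc k)) (\<lambda>xs. G (xs ! 0) (xs ! 1) (drop 2 xs))"
  shows "recursive k (\<lambda>xs. rec_nat (F xs) (\<lambda>m y. G m y xs) (N xs))"
proof -
  obtain p where p: "query_free p" "\<And>xs. length xs = k \<Longrightarrow> runs {} p xs (F xs)"
    using assms(2) by (auto simp: recursive_def)
  obtain q where q: "query_free q" "\<And>xs. length xs = Suc (Suc k) \<Longrightarrow>
      runs {} q xs (G (xs ! 0) (xs ! 1) (drop 2 xs))"
    using assms(3) by (auto simp: recursive_def)
  have "runs {} (PrimRec p q) (n # xs) (rec_nat (F xs) (\<lambda>m y. G m y xs) n)"
    if "length xs = k" for n xs
  proof (induction n)
    case 0
    show ?case using that by (auto intro: runs_PrimRec_0 p)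
  next
    case (Suc n)
    show ?case using q(2)[of "n # rec_nat (F xs) (\<lambda>m y. G m y xs) n # xs"] that
      by (auto intro: runs_PrimRec_Suc[OF Suc])
  qed
  then have "runs {} (PrimRec p q) xs (rec_nat (F (drop 1 xs)) (\<lambda>m y. G m y (drop 1 xs)) (xs ! 0))"
    if "length xs = Suc k" for xs
    using that by (auto simp: length_Suc_conv)
  then have "recursive (Suc k) (\<lambda>xs. rec_nat (F (drop 1 xs)) (\<lambda>m y. G m y (drop 1 xs)) (xs ! 0))"
    unfolding recursive_def using p(1) q(1) by (intro exI[of _ "PrimRec p q"]) auto
  \<comment> \<open>\<open>PrimRec\<close> takes its counter from the head of the list; feeding it
    \<open>N xs\<close> followed by all of \<open>xs\<close> gives recursion up to a computed
    bound.\<close>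
  then have "recursive k (\<lambda>xs. (\<lambda>xs. rec_nat (F (drop 1 xs)) (\<lambda>m y. G m y (drop 1 xs)) (xs ! 0))
      (map (\<lambda>G. G xs) (N # map (\<lambda>i xs. xs ! i) [0..<k])))"
    by (rule recursive_comp) (auto intro: assms recursive_proj)
  then show ?thesis
  proof (rule recursive_cong)
    fix xs :: "nat list" assume "length xs = k"
    then have "map (\<lambda>G. G xs) (map (\<lambda>i xs. xs ! i) [0..<k]) = xs"
      by (intro nth_equalityI) auto
    then show "(\<lambda>xs. rec_nat (F (drop 1 xs)) (\<lambda>m y. G m y (drop 1 xs)) (xs ! 0))
      (map (\<lambda>G. G xs) (N # map (\<lambda>i xs. xs ! i) [0..<k])) =
      rec_nat (F xs) (\<lambda>m y. G m y xs) (N xs)"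
      by (simp add: comp_def)
  qed
qed

text \<open>\<open>Mu\<close> looks for the value 0, the truth value of a false statement, hence the
  negation. The second assumption makes the search total.\<close>

lemma recursive_Least:
  assumes "recursive (Suc k) (\<lambda>xs. of_bool (P (xs ! 0) (drop 1 xs)))"
    and "\<And>xs. length xs = k \<Longrightarrow> \<exists>n. \<not> P n xs"
  shows "recursive k (\<lambda>xs. LEAST n. \<not> P n xs)"
proof -
  obtain p where p: "query_free p" "\<And>xs. length xs = Suc k \<Longrightarrow>
      runs {} p xs (of_bool (P (xs ! 0) (drop 1 xs)))"
    using assms(1) by (auto simp: recursive_def)
  have run: "runs {} p (n # xs) (of_bool (P n xs))" if "length xs = k" for n xs
    using p(2)[of "n # xs"] that by simp
  have "runs {} (Mu p) xs (LEAST n. \<not> P n xs)" if len: "length xs = k" for xs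
  proof (rule runs_Mu)
    have "\<not> P (LEAST n. \<not> P n xs) xs" using assms(2)[OF len] by (rule LeastI_ex)
    then show "runs {} p ((LEAST n. \<not> P n xs) # xs) 0"
      using run[OF len, of "LEAST n. \<not> P n xs"] by simp
    have "runs {} p (m # xs) 1" if m: "m < (LEAST n. \<not> P n xs)" for m
      using run[OF len, of m] not_less_Least[OF m] by simp
    then show "\<forall>m<(LEAST n. \<not> P n xs). \<exists>k>0. runs {} p (m # xs) k"
      by (meson zero_less_one)
  qed
  then show ?thesis
    unfolding recursive_def using p(1) by (intro exI[of _ "Mu p"]) auto
qed

text \<open>Primitive recursion on the truth value of \<open>P xs\<close>: at 0 it yields
  \<open>G xs\<close>, and one step, ignoring the previous value, yields
  \<open>F xs\<close>.\<close>

lemma recursive_if: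
  assumes "decidable k P" "recursive k F" "recursive k G"
  shows "recursive k (\<lambda>xs. if P xs then F xs else G xs)"
  using recursive_rec_nat[OF assms(1,3), of "\<lambda>m y. F"] recursive_drop2[OF assms(2)]
  by (auto elim!: recursive_cong)

section \<open>Arithmetic, connectives and bounded quantifiers\<close>

lemma recursive_pred: "recursive k F \<Longrightarrow> recursive k (\<lambda>xs. F xs - 1)"
proof -
  have "rec_nat 0 (\<lambda>m y. m) n = n - 1" for n :: nat by (cases n) auto
  then show "recursive k F \<Longrightarrow> recursive k (\<lambda>xs. F xs - 1)"
    using recursive_rec_nat[of k F "\<lambda>_. 0" "\<lambda>m y xs. m"]
    by (simp add: recursive_const recursive_proj)
qed

lemma recursive_add:
  "recursive k F \<Longrightarrow> recursive k G \<Longrightarrow> recursive k (\<lambda>xs. F xs + G xs)"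
proof -
  have "rec_nat a (\<lambda>m. Suc) b = a + b" for a b :: nat by (induction b) auto
  then show "recursive k F \<Longrightarrow> recursive k G \<Longrightarrow> recursive k (\<lambda>xs. F xs + G xs)"
    using recursive_rec_nat[of k G F "\<lambda>m y xs. Suc y"]
    by (simp add: recursive_Suc recursive_proj)
qed

lemma recursive_diff:
  "recursive k F \<Longrightarrow> recursive k G \<Longrightarrow> recursive k (\<lambda>xs. F xs - G xs)"
proof -
  have "rec_nat a (\<lambda>m y. y - 1) b = a - b" for a b :: nat by (induction b) auto
  then show "recursive k F \<Longrightarrow> recursive k G \<Longrightarrow> recursive k (\<lambda>xs. F xs - G xs)"
    using recursive_rec_nat[of k G F "\<lambda>m y xs. y - 1"] recursive_pred[OF recursive_proj[of 1]]
    by simp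
qed

lemma decidable_eq_0: "recursive k F \<Longrightarrow> decidable k (\<lambda>xs. F xs = 0)"
  by (rule recursive_cong[OF recursive_diff[OF recursive_const[of k 1]]]) auto

lemma decidable_not: "decidable k P \<Longrightarrow> decidable k (\<lambda>xs. \<not> P xs)"
  by (rule recursive_cong[OF recursive_diff[OF recursive_const[of k 1]]]) auto

lemma decidable_conj: "decidable k P \<Longrightarrow> decidable k Q \<Longrightarrow> decidable k (\<lambda>xs. P xs \<and> Q xs)"
  by (rule recursive_cong[OF recursive_if[OF _ _ recursive_const[of k 0], of P "\<lambda>xs. of_bool (Q xs)"]])
    auto

lemma decidable_imp: "decidable k P \<Longrightarrow> decidable k Q \<Longrightarrow> decidable k (\<lambda>xs. P xs \<longrightarrow> Q xs)"
  by (rule recursive_cong[OF recursive_if[OF _ _ recursive_const[of k 1], of P "\<lambda>xs. of_bool (Q xs)"]])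
    auto

text \<open>Both truncated differences vanish exactly when the two numbers are equal.\<close>

lemma decidable_eq_const: "recursive k F \<Longrightarrow> decidable k (\<lambda>xs. F xs = n)"
  by (rule recursive_cong[OF decidable_conj[OF decidable_eq_0 decidable_eq_0,
      OF recursive_diff recursive_diff, of k F "\<lambda>_. n" "\<lambda>_. n" F]])
    (auto intro: recursive_const)

lemma decidable_ball_list:
  "(\<And>y. y \<in> set ys \<Longrightarrow> decidable k (P y)) \<Longrightarrow> decidable k (\<lambda>xs. \<forall>y\<in>set ys. P y xs)"
proof (induction ys)
  case Nil
  then show ?case using recursive_const[of k 1] by simp
next
  case (Cons y ys)
  then show ?case using decidable_conj[of k "P y"] by simp
qed

lemma decidable_ball_less:
  assumes "decidable (Suc k) (\<lambda>xs. P (xs ! 0) (drop 1 xs))" "recursive k N"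
  shows "decidable k (\<lambda>xs. \<forall>m<N xs. P m xs)"
proof -
  have eq: "rec_nat 1 (\<lambda>m y. if P m xs then y else 0) n = of_bool (\<forall>m<n. P m xs)" for xs n
    by (induction n) (auto simp: less_Suc_eq)
  \<comment> \<open>Inside the recursion, index 1 holds the truth value accumulated so far; this
    composition skips it to reach the arguments of \<open>P\<close>.\<close>
  have "recursive (Suc (Suc k)) (\<lambda>xs. (\<lambda>xs. of_bool (P (xs ! 0) (drop 1 xs)))
      (map (\<lambda>G. G xs) ((\<lambda>xs. xs ! 0) # map (\<lambda>i xs. xs ! (2 + i)) [0..<k])))"
    using assms(1) by (rule recursive_comp) (auto intro: recursive_proj)
  then have "decidable (Suc (Suc k)) (\<lambda>xs. P (xs ! 0) (drop 2 xs))"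
  proof (rule recursive_cong)
    fix xs :: "nat list" assume "length xs = Suc (Suc k)"
    then have "map (\<lambda>G. G xs) (map (\<lambda>i xs. xs ! (2 + i)) [0..<k]) = drop 2 xs"
      by (intro nth_equalityI) auto
    then show "(\<lambda>xs. of_bool (P (xs ! 0) (drop 1 xs)))
      (map (\<lambda>G. G xs) ((\<lambda>xs. xs ! 0) # map (\<lambda>i xs. xs ! (2 + i)) [0..<k]))
      = of_bool (P (xs ! 0) (drop 2 xs))" by (simp add: comp_def)
  qed
  then have "recursive (Suc (Suc k)) (\<lambda>xs. if P (xs ! 0) (drop 2 xs) then xs ! 1 else 0)"
    by (intro recursive_if recursive_proj recursive_const) auto
  from recursive_rec_nat[OF assms(2) recursive_const this, of 1] show ?thesis
    unfolding eq .
qed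

lemma decidable_even: "recursive k F \<Longrightarrow> decidable k (\<lambda>xs. even (F xs))"
proof -
  have "rec_nat 1 (\<lambda>m y. 1 - y) n = (of_bool (even n) :: nat)" for n by (induction n) auto
  moreover have "recursive (Suc (Suc k)) (\<lambda>xs. 1 - xs ! 1)"
    by (intro recursive_diff recursive_proj recursive_const) auto
  ultimately show "recursive k F \<Longrightarrow> decidable k (\<lambda>xs. even (F xs))"
    using recursive_rec_nat[of k F "\<lambda>_. 1" "\<lambda>m y xs. 1 - y"] recursive_const by simp
qed

lemma recursive_div2: "recursive k F \<Longrightarrow> recursive k (\<lambda>xs. F xs div 2)"
proof -
  have "rec_nat 0 (\<lambda>m y. if even m then y else Suc y) n = n div 2" for n
    by (induction n) auto
  moreover have "recursive (Suc (Suc k)) (\<lambda>xs. if even (xs ! 0) then xs ! 1 else Suc (xs ! 1))"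
    by (intro recursive_if recursive_Suc recursive_proj decidable_even) auto
  ultimately show "recursive k F \<Longrightarrow> recursive k (\<lambda>xs. F xs div 2)"
    using recursive_rec_nat[of k F "\<lambda>_. 0" "\<lambda>m y xs. if even m then y else Suc y"] recursive_const
    by simp
qed

text \<open>Membership of \<open>x\<close> in the set coded by \<open>n\<close> is oddness of
  \<open>n\<close> after \<open>x\<close> halvings.\<close>

lemma decidable_set_decode:
  "recursive k F \<Longrightarrow> recursive k G \<Longrightarrow> decidable k (\<lambda>xs. F xs \<in> set_decode (G xs))"
proof -
  have *: "rec_nat n (\<lambda>m y. y div 2) x = n div 2 ^ x" for n x :: nat
    by (induction x) (auto simp: div_mult2_eq[symmetric] mult.commute)
  assume "recursive k F" "recursive k G"
  then have "recursive k (\<lambda>xs. rec_nat (G xs) (\<lambda>m y. y div 2) (F xs))"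
    by (rule recursive_rec_nat) (intro recursive_div2 recursive_proj, auto)
  from decidable_not[OF decidable_even[OF this]] show ?thesis
    by (simp add: set_decode_def *)
qed

section \<open>From recursive functions to \<open>computable\<close> and \<open>ce\<close>\<close>

lemma computable_if_recursive: "recursive 1 (\<lambda>xs. f (xs ! 0)) \<Longrightarrow> computable f"
  unfolding recursive_def computable_def by (metis length_Cons list.size(3) nth_Cons_0 One_nat_def)

text \<open>Minimize over a dummy variable that the predicate ignores: the search stops at 0 if
  \<open>P n\<close> holds and never stops otherwise.\<close>

lemma ce_if_decidable:
  assumes "decidable 1 (\<lambda>xs. P (xs ! 0))"
  shows "ce {n. P n}"
proof -
  have "decidable 2 (\<lambda>xs. \<not> P (xs ! 1))"
    using decidable_not[OF recursive_drop1[OF assms]] by (auto elim!: recursive_cong simp: numeral_2_eq_2)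
  then obtain p where p: "query_free p"
    "\<And>xs. length xs = 2 \<Longrightarrow> runs {} p xs (of_bool (\<not> P (xs ! 1)))"
    by (auto simp: recursive_def)
  have run: "runs {} p [m, n] (of_bool (\<not> P n))" for m n using p(2)[of "[m, n]"] by simp
  have "(\<exists>y. runs {} (Mu p) [n] y) \<longleftrightarrow> P n" for n
  proof
    assume "\<exists>y. runs {} (Mu p) [n] y"
    then obtain y where "runs {} p [y, n] 0" by (auto elim: runs_MuE)
    then show "P n" using runs_deterministic[OF run] by (metis of_bool_eq_0_iff)
  next
    assume "P n"
    then have "runs {} (Mu p) [n] 0" using run[of 0 n] by (intro runs_Mu) auto
    then show "\<exists>y. runs {} (Mu p) [n] y" ..
  qed
  then show ?thesis unfolding ce_def using p(1) by (intro exI[of _ "Mu p"]) auto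
qed


section \<open>Bounded evaluation with a finite oracle\<close>

text \<open>Each step \<open>(y - 1) div 2\<close> removes the first bit of the coded string. What
  remains has code 0 if empty; otherwise its first bit is true exactly if the code is even. The
  result is 0 for a bit beyond the end, else the successor of the bit.\<close>

definition query_bit :: "nat \<Rightarrow> nat \<Rightarrow> nat" where
  "query_bit c n = (let d = rec_nat c (\<lambda>m y. (y - 1) div 2) n in
    if d = 0 then 0 else if even d then 2 else 1)"

(* State of the search for a zero: 0 if an undefined value has been met, 1 if the search
   goes on, n + 2 if the zero n has been found. *)
definition search :: "(nat \<Rightarrow> nat) \<Rightarrow> nat \<Rightarrow> nat" where
  "search v = rec_nat 1 (\<lambda>j s. if s = 1 then if v j = 0 then 0 else if v j = 1 then Suc (Suc j) else 1
    else s)"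

(* The string coded by c is the oracle, and c itself bounds the searches.
   The value 0 stands for "undefined", and Suc y for the value y. *)
primrec ev :: "prog \<Rightarrow> nat \<Rightarrow> nat list \<Rightarrow> nat" where
  "ev Zero c xs = 1"
| "ev Succ c xs = (if length xs = 1 then Suc (Suc (hd xs)) else 0)"
| "ev (Proj i) c xs = (if i < length xs then Suc (xs ! i) else 0)"
| "ev Query c xs = (if length xs = 1 then query_bit c (hd xs) else 0)"
| "ev (Comp p qs) c xs =
    (if \<forall>q\<in>set (map ev qs). q c xs \<noteq> 0 then ev p c (map (\<lambda>q. q c xs - 1) (map ev qs)) else 0)"
| "ev (PrimRec p q) c xs =
    (case xs of [] \<Rightarrow> 0 | n # zs \<Rightarrow>
      rec_nat (ev p c zs) (\<lambda>m y. if y = 0 then 0 else ev q c (m # (y - 1) # zs)) n)"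
| "ev (Mu p) c xs = search (\<lambda>j. ev p c (j # xs)) c - 1"

lemma recursive_query_bit:
  assumes "recursive k C" "recursive k N"
  shows "recursive k (\<lambda>xs. query_bit (C xs) (N xs))"
proof -
  have "recursive k (\<lambda>xs. rec_nat (C xs) (\<lambda>m y. (y - 1) div 2) (N xs))"
    by (intro recursive_rec_nat assms recursive_div2 recursive_pred recursive_proj) auto
  then show ?thesis unfolding query_bit_def Let_def
    by (intro recursive_if decidable_eq_0 decidable_even recursive_const)
qed

text \<open>The arguments are a fixed list of functions, so their number is known in advance and the
  tests on lengths in \<open>ev\<close> are settled for each program. The arity \<open>k\<close>
  varies in the induction because recursion and search add two variables.\<close>

lemma recursive_ev:
  "recursive k C \<Longrightarrow> (\<And>G. G \<in> set Gs \<Longrightarrow> recursive k G) \<Longrightarrow>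
    recursive k (\<lambda>xs. ev p (C xs) (map (\<lambda>G. G xs) Gs))"
proof (induction p arbitrary: k C Gs)
  case Zero
  show ?case by (simp add: recursive_const)
next
  case Succ
  then show ?case
    by (cases Gs; cases "tl Gs") (auto intro!: recursive_const recursive_Suc)
next
  case (Proj i)
  then show ?case
    by (cases "i < length Gs") (auto intro!: recursive_const recursive_Suc)
next
  case Query
  then show ?case
    by (cases Gs; cases "tl Gs") (auto intro!: recursive_const recursive_query_bit)
next
  case (Comp p qs)
  let ?H = "\<lambda>q xs. ev q (C xs) (map (\<lambda>G. G xs) Gs)"
  have H: "recursive k (?H q)" if "q \<in> set qs" for q
    using Comp that by blast
  have "recursive k (\<lambda>xs. ev p (C xs) (map (\<lambda>G. G xs) (map (\<lambda>q xs. ?H q xs - 1) qs)))"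
    using Comp.prems(1) H
    by - (rule Comp.IH(1), auto simp del: map_map One_nat_def intro!: recursive_pred)
  moreover have "decidable k (\<lambda>xs. \<forall>q\<in>set qs. ?H q xs \<noteq> 0)"
    by (intro decidable_ball_list decidable_not decidable_eq_0 H)
  ultimately show ?case using recursive_if[OF _ _ recursive_const[of k 0]]
    by (auto simp: comp_def)
next
  case (PrimRec p q)
  show ?case
  proof (cases Gs)
    case Nil
    then show ?thesis by (simp add: recursive_const)
  next
    case (Cons N Hs)
    \<comment> \<open>Index 0 is the counter and index 1 the encoded previous value, decoded by
      subtracting 1.\<close>
    have "recursive (Suc (Suc k)) (\<lambda>xs. ev q (C (drop 2 xs)) (map (\<lambda>G. G xs)
        ((\<lambda>xs. xs ! 0) # (\<lambda>xs. xs ! 1 - 1) # map (\<lambda>G xs. G (drop 2 xs)) Hs)))"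
      using PrimRec.prems Cons
      by (intro PrimRec.IH recursive_drop2)
        (auto simp del: One_nat_def intro!: recursive_drop2 recursive_proj recursive_pred)
    then have "recursive (Suc (Suc k)) (\<lambda>xs. if xs ! 1 = 0 then 0 else
        ev q (C (drop 2 xs)) (xs ! 0 # (xs ! 1 - 1) # map (\<lambda>G. G (drop 2 xs)) Hs))"
      by (intro recursive_if decidable_eq_0 recursive_proj recursive_const) (auto simp: comp_def)
    then show ?thesis using PrimRec.prems Cons
      by (simp, intro recursive_rec_nat PrimRec.IH) auto
  qed
next
  case (Mu p)
  let ?v = "\<lambda>j xs. ev p (C xs) (j # map (\<lambda>G. G xs) Gs)"
  have "recursive (Suc (Suc k)) (\<lambda>xs. ev p (C (drop 2 xs)) (map (\<lambda>G. G xs)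
      ((\<lambda>xs. xs ! 0) # map (\<lambda>G xs. G (drop 2 xs)) Gs)))"
    using Mu.prems by (intro Mu.IH recursive_drop2) (auto intro!: recursive_drop2 recursive_proj)
  then have *: "recursive (Suc (Suc k)) (\<lambda>xs. ?v (xs ! 0) (drop 2 xs))"
    by (simp add: comp_def)
  show ?case
    using * Mu.prems(1) unfolding search_def ev.simps
    by (intro recursive_pred recursive_rec_nat recursive_if decidable_eq_const recursive_Suc
        recursive_const recursive_proj) auto
qed

section \<open>Correctness of the bounded evaluation\<close>

lemma query_bit_eq:
  "query_bit (string_code \<sigma>) n = (if n < length \<sigma> then Suc (of_bool (\<sigma> ! n)) else 0)"
proof -
  have "rec_nat (string_code \<sigma>) (\<lambda>m y. (y - 1) div 2) n = string_code (drop n \<sigma>)" for n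
  proof (induction n)
    case (Suc n)
    \<comment> \<open>This includes the empty string, since truncated subtraction keeps 0 at
      0.\<close>
    have "(string_code \<tau> - 1) div 2 = string_code (tl \<tau>)" for \<tau> by (cases \<tau>) auto
    with Suc show ?case by (simp add: drop_Suc tl_drop)
  qed simp
  then show ?thesis
    by (cases "n < length \<sigma>") (auto simp: query_bit_def Let_def Cons_nth_drop_Suc[symmetric])
qed

lemma search_Suc: "search v (Suc m) =
    (if search v m = 1 then if v m = 0 then 0 else if v m = 1 then Suc (Suc m) else 1
     else search v m)"
  by (simp add: search_def)

lemma search_eq_1: "search v m = 1 \<longleftrightarrow> (\<forall>j<m. v j > 1)"
  by (induction m) (auto simp: search_Suc less_Suc_eq, simp add: search_def)

text \<open>For encoded values, 1 means the value 0 and anything larger a defined positive value, so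
  the right side is the condition for \<open>Mu\<close> to yield \<open>n\<close>, with
  \<open>n\<close> below the bound.\<close>

lemma search_eq_Suc_Suc: "search v m = Suc (Suc n) \<longleftrightarrow> n < m \<and> v n = 1 \<and> (\<forall>j<n. v j > 1)"
proof (induction m)
  case 0
  show ?case by (simp add: search_def)
next
  case (Suc m)
  show ?case
  proof (cases "search v m = 1")
    case True
    then show ?thesis using search_eq_1[of v m]
      by (auto simp: search_Suc less_Suc_eq dest: spec[of _ n])
  next
    case False
    \<comment> \<open>The search has ended before \<open>m\<close>: its state is frozen, and
      \<open>m\<close> itself cannot be the zero found.\<close>
    then have "\<exists>j<m. v j \<le> 1" using search_eq_1[of v m] by (auto simp: not_less)
    then show ?thesis using False Suc by (auto simp: search_Suc less_Suc_eq)
  qed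
qed

text \<open>Soundness: a query is answered only inside \<sigma>, where \<sigma> agrees with
  \<open>X\<close>; any other query makes the evaluation undefined.\<close>

lemma runs_if_ev:
  assumes "initial_segment \<sigma> X"
  shows "ev p (string_code \<sigma>) xs = Suc y \<Longrightarrow> runs X p xs y"
proof (induction p arbitrary: xs y)
  case Zero
  then show ?case by (auto intro: runs_Zero)
next
  case Succ
  then show ?case by (auto simp: length_Suc_conv intro: runs_Succ split: if_splits)
next
  case (Proj i)
  then show ?case by (auto intro: runs_Proj split: if_splits)
next
  case Query
  then obtain n where n: "xs = [n]" by (auto simp: length_Suc_conv split: if_splits)
  then have "n < length \<sigma>" "y = of_bool (\<sigma> ! n)" using Query by (auto simp: query_bit_eq split: if_splits)
  then have "y = of_bool (n \<in> X)" using assms by (simp add: initial_segment_def)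
  then show ?case unfolding n by (simp only: runs_Query)
next
  case (Comp p qs)
  let ?ys = "map (\<lambda>q. ev q (string_code \<sigma>) xs - 1) qs"
  from Comp.prems have nz: "\<forall>q\<in>set qs. ev q (string_code \<sigma>) xs \<noteq> 0"
    and p: "ev p (string_code \<sigma>) ?ys = Suc y" by (auto simp: comp_def split: if_splits)
  have "runs X q xs (ev q (string_code \<sigma>) xs - 1)" if "q \<in> set qs" for q
    using Comp.IH(2)[OF that] nz that by (metis Suc_pred' gr0I)
  then show ?case
    using Comp.IH(1)[OF p] by (intro runs_Comp[where ys = ?ys]) (auto simp: list_all2_conv_all_nth)
next
  case (PrimRec p q)
  from PrimRec.prems obtain n zs where xs: "xs = n # zs" by (cases xs) auto
  have "runs X (PrimRec p q) (n # zs) y" using PrimRec.prems unfolding xs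
  proof (induction n arbitrary: y)
    case 0
    then show ?case using PrimRec.IH(1) by (auto intro: runs_PrimRec_0)
  next
    case (Suc n)
    then obtain z where z: "ev (PrimRec p q) (string_code \<sigma>) (n # zs) = Suc z"
      and y: "ev q (string_code \<sigma>) (n # z # zs) = Suc y"
      by (cases "ev (PrimRec p q) (string_code \<sigma>) (n # zs)") auto
    from Suc.IH[OF z] PrimRec.IH(2)[OF y] show ?case by (rule runs_PrimRec_Suc)
  qed
  then show ?case unfolding xs .
next
  case (Mu p)
  then have "search (\<lambda>j. ev p (string_code \<sigma>) (j # xs)) (string_code \<sigma>) = Suc (Suc y)" by simp
  then have y: "ev p (string_code \<sigma>) (y # xs) = Suc 0"
    and less: "\<And>j. j < y \<Longrightarrow> ev p (string_code \<sigma>) (j # xs) > 1"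
    unfolding search_eq_Suc_Suc by auto
  have "\<exists>k>0. runs X p (j # xs) k" if "j < y" for j
    using Mu.IH[of "j # xs" "ev p (string_code \<sigma>) (j # xs) - 1"] less[OF that]
    by (intro exI[of _ "ev p (string_code \<sigma>) (j # xs) - 1"]) auto
  with Mu.IH[OF y] show ?case by (intro runs_Mu) auto
qed

definition restriction :: "nat set \<Rightarrow> nat \<Rightarrow> bool list" where
  "restriction X n = map (\<lambda>k. k \<in> X) [0..<n]"

lemma length_restriction [simp]: "length (restriction X n) = n"
  by (simp add: restriction_def)

lemma prefix_restriction:
  assumes "initial_segment \<sigma> X" "length \<sigma> \<le> n"
  shows "prefix \<sigma> (restriction X n)"
proof -
  have "restriction X n = \<sigma> @ drop (length \<sigma>) (restriction X n)"
    using assms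
    by (intro nth_equalityI) (auto simp: nth_append initial_segment_def restriction_def)
  then show ?thesis by (rule prefixI)
qed

text \<open>This lets one number serve as oracle and as search bound: long strings give large
  bounds.\<close>

lemma length_le_string_code: "length \<sigma> \<le> string_code \<sigma>"
  by (induction \<sigma>) auto

text \<open>Completeness. Finitely many conditions that hold for all sufficiently long restrictions
  hold jointly, so neither the use of a computation nor monotonicity of \<open>ev\<close> in the
  stage has to be tracked.\<close>

lemma ev_if_runs:
  "runs X p xs y \<Longrightarrow> \<forall>\<^sub>F n in at_top. ev p (string_code (restriction X n)) xs = Suc y"
proof (induction rule: runs.induct)
  case (runs_Query m)
  show ?case using eventually_gt_at_top[of m]
    by eventually_elim (simp add: query_bit_eq restriction_def)
next
  case (runs_Comp xs qs ys p z)
  have "\<forall>\<^sub>F n in at_top. map (\<lambda>q. ev q (string_code (restriction X n)) xs) qs = map Suc ys"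
    using runs_Comp.IH(1)
  proof (induction rule: list_all2_induct)
    case (Cons q qs y ys)
    from conjunct2[OF Cons(1)] Cons(3) show ?case by eventually_elim simp
  qed simp
  then show ?case using runs_Comp.IH(2)
  proof eventually_elim
    case (elim n)
    let ?c = "string_code (restriction X n)"
    have "\<forall>q\<in>set qs. ev q ?c xs \<noteq> 0"
      using arg_cong[OF elim(1), of set] by (force simp: image_iff)
    moreover have "map (\<lambda>q. ev q ?c xs - 1) qs = ys"
      using arg_cong[OF elim(1), of "map (\<lambda>y. y - 1)"] by (simp add: comp_def)
    ultimately show ?case using elim(2) by (simp add: comp_def)
  qed
next
  case (runs_PrimRec_Suc p q n xs y z)
  from runs_PrimRec_Suc.IH show ?case by eventually_elim simp
next
  case (runs_Mu p m xs)
  have "\<forall>\<^sub>F n in at_top. \<forall>j\<in>{..<m}. ev p (string_code (restriction X n)) (j # xs) > 1"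
  proof (rule eventually_ball_finite)
    show "\<forall>j\<in>{..<m}. \<forall>\<^sub>F n in at_top. ev p (string_code (restriction X n)) (j # xs) > 1"
    proof
      fix j assume "j \<in> {..<m}"
      then obtain k where "k > 0"
        "\<forall>\<^sub>F n in at_top. ev p (string_code (restriction X n)) (j # xs) = Suc k"
        using runs_Mu.IH(2) by auto
      from this(2) show "\<forall>\<^sub>F n in at_top. ev p (string_code (restriction X n)) (j # xs) > 1"
        by eventually_elim (use \<open>k > 0\<close> in simp)
    qed
  qed simp
  with runs_Mu.IH(1) eventually_gt_at_top[of m] show ?case
  proof eventually_elim
    case (elim n)
    have "m < string_code (restriction X n)"
      using length_le_string_code[of "restriction X n"] elim(2) by simp
    then have "search (\<lambda>j. ev p (string_code (restriction X n)) (j # xs)) (string_code (restriction X n))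
      = Suc (Suc m)" unfolding search_eq_Suc_Suc using elim by auto
    then show ?case by simp
  qed
qed simp_all

section \<open>Approximations in stages\<close>

text \<open>The stage \<open>c\<close> is a string code, so that it can be shared with
  \<open>ev\<close>. No monotonicity in \<open>c\<close> is demanded: a positive answer is always
  correct, and a member is recognized at all late stages along any set \<open>X\<close>.\<close>

definition approximation :: "(nat \<Rightarrow> nat \<Rightarrow> nat \<Rightarrow> bool) \<Rightarrow> (nat \<Rightarrow> nat set) \<Rightarrow> bool" where
  "approximation a A \<longleftrightarrow> decidable 3 (\<lambda>xs. a (xs ! 0) (xs ! 1) (xs ! 2)) \<and>
    (\<forall>c i n. a c i n \<longrightarrow> n \<in> A i) \<and>
    (\<forall>X i n. n \<in> A i \<longrightarrow> (\<forall>\<^sub>F m in at_top. a (string_code (restriction X m)) i n))"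

lemma decidable_approximation:
  assumes "decidable 3 (\<lambda>xs. a (xs ! 0) (xs ! 1) (xs ! 2))"
    and "recursive k C" "recursive k I" "recursive k N"
  shows "decidable k (\<lambda>xs. a (C xs) (I xs) (N xs))"
  using recursive_comp[OF assms(1), of "[C, I, N]" k] assms(2-) by (auto simp: eval_nat_numeral)

lemma approximation_if_uniformly_ce:
  assumes "uniformly_ce A"
  obtains a where "approximation a A"
proof -
  obtain p where p: "query_free p" "\<And>i. A i = {n. \<exists>y. runs {} p [i, n] y}"
    using assms by (auto simp: uniformly_ce_def)
  let ?a = "\<lambda>c i n. ev p c [i, n] \<noteq> 0"
  have "decidable 3 (\<lambda>xs. ?a (xs ! 0) (xs ! 1) (xs ! 2))"
    using recursive_ev[of 3 "\<lambda>xs. xs ! 0" "[\<lambda>xs. xs ! 1, \<lambda>xs. xs ! 2]" p]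
    by (intro decidable_not decidable_eq_0) (fastforce simp: recursive_proj)
  moreover have "n \<in> A i" if a: "?a c i n" for c i n
  proof -
    \<comment> \<open>Every stage codes a string, which is an initial segment of the set of
      positions of its true bits; soundness applies to that oracle, which is then replaced by the
      empty set as \<open>p\<close> is query-free.\<close>
    obtain \<sigma> where "c = string_code \<sigma>" using bij_is_surj[OF bij_string_code] by (metis surjD)
    moreover have "initial_segment \<sigma> {k. k < length \<sigma> \<and> \<sigma> ! k}" by (simp add: initial_segment_def)
    moreover obtain y where "ev p c [i, n] = Suc y" using a by (auto simp: gr0_conv_Suc)
    ultimately show ?thesis using runs_if_ev query_free_runs p by fast
  qed
  moreover have "\<forall>\<^sub>F m in at_top. ?a (string_code (restriction X m)) i n" if n: "n \<in> A i" for X i n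
  proof -
    obtain y where "runs X p [i, n] y" using n p query_free_runs by blast
    from ev_if_runs[OF this] show ?thesis by eventually_elim simp
  qed
  ultimately show thesis by (intro that[of ?a]) (simp add: approximation_def)
qed

text \<open>A finite set contained in \<open>A i\<close> is recognized as soon as all its elements
  are. Elements of the set coded by \<open>n\<close> are below \<open>n\<close>, as
  \<open>x < 2 ^ x \<le> n\<close>, so the quantifier is bounded and decidability is kept.\<close>

lemma approximation_finite_subset_codes:
  assumes "approximation a A"
  shows "approximation (\<lambda>c i n. \<forall>x<n. x \<in> set_decode n \<longrightarrow> a c i x) (\<lambda>i. finite_subset_codes (A i))"
proof -
  have less: "x < n" if "x \<in> set_decode n" for x n
  proof -
    have "n div 2 ^ x \<noteq> 0" using that by (intro notI) (simp add: set_decode_def)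
    then have "2 ^ x \<le> n" by (simp add: div_eq_0_iff not_less)
    then show ?thesis by (meson less_exp less_le_trans)
  qed
  have dec: "decidable 3 (\<lambda>xs. a (xs ! 0) (xs ! 1) (xs ! 2))" using assms by (simp add: approximation_def)
  have "decidable (Suc 3) (\<lambda>xs. xs ! 0 \<in> set_decode (drop 1 xs ! 2) \<longrightarrow>
      a (drop 1 xs ! 0) (drop 1 xs ! 1) (xs ! 0))"
    by (intro decidable_imp decidable_set_decode decidable_approximation[OF dec]
        recursive_drop1[of 3 "\<lambda>xs. xs ! i" for i] recursive_proj) auto
  then have "decidable 3 (\<lambda>xs. \<forall>x<xs ! 2. x \<in> set_decode (xs ! 2) \<longrightarrow> a (xs ! 0) (xs ! 1) x)"
    by (rule decidable_ball_less) (auto intro: recursive_proj)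
  moreover have "\<forall>\<^sub>F m in at_top. \<forall>x<n. x \<in> set_decode n \<longrightarrow> a (string_code (restriction X m)) i x"
    if "set_decode n \<subseteq> A i" for X i n
  proof -
    have "\<forall>\<^sub>F m in at_top. \<forall>x\<in>set_decode n. a (string_code (restriction X m)) i x"
      using assms that by (intro eventually_ball_finite) (auto simp: approximation_def)
    then show ?thesis by eventually_elim simp
  qed
  moreover have "set_decode n \<subseteq> A i" if "\<forall>x<n. x \<in> set_decode n \<longrightarrow> a c i x" for c i n
    using assms that less unfolding approximation_def by blast
  ultimately show ?thesis
    unfolding approximation_def finite_subset_codes_def by blast
qed

section \<open>Selectors below a 1-generic set\<close>

text \<open>For fixed \<sigma>, prepending it applies finitely many maps of the form
  \<open>2 * c + 1\<close> or \<open>2 * c + 2\<close> to the code.\<close>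

lemma recursive_string_code_append:
  assumes "recursive k F" "\<And>xs. length xs = k \<Longrightarrow> F xs = string_code (\<tau> xs)"
  shows "recursive k (\<lambda>xs. string_code (\<sigma> @ \<tau> xs))"
proof (induction \<sigma>)
  case Nil
  show ?case using assms by (auto elim: recursive_cong)
next
  case (Cons b \<sigma>)
  then have "recursive k (\<lambda>xs. (string_code (\<sigma> @ \<tau> xs) + string_code (\<sigma> @ \<tau> xs)) + (if b then 2 else 1))"
    by (intro recursive_add recursive_const)
  then show ?case by (rule recursive_cong) simp
qed

lemma computable_selector:
  assumes "one_generic X" "approximation a A" "approximation b B"
    and f: "computable_in X f" "selector (\<lambda>i. A i - B i) f"
  obtains g where "computable g" "selector (\<lambda>i. A i - B i) g"
proof -
  obtain p where p: "\<And>i. runs X p [i] (f i)" using f(1) by (auto simp: computable_in_def)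
  have fi: "f i \<in> A i" "f i \<notin> B i" for i using f(2) by (auto simp: selector_def)
  have ab: "decidable 3 (\<lambda>xs. a (xs ! 0) (xs ! 1) (xs ! 2))"
      "decidable 3 (\<lambda>xs. b (xs ! 0) (xs ! 1) (xs ! 2))"
    "\<And>c i n. a c i n \<Longrightarrow> n \<in> A i" "\<And>c i n. b c i n \<Longrightarrow> n \<in> B i"
    "\<And>Y i n. n \<in> A i \<Longrightarrow> \<forall>\<^sub>F m in at_top. a (string_code (restriction Y m)) i n"
    "\<And>Y i n. n \<in> B i \<Longrightarrow> \<forall>\<^sub>F m in at_top. b (string_code (restriction Y m)) i n"
    using assms(2,3) by (auto simp: approximation_def)
  have ev1: "recursive k (\<lambda>xs. ev p (C xs) [I xs])" if "recursive k C" "recursive k I" for k C I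
    using recursive_ev[of k C "[I]" p] that by simp

  \<comment> \<open>The code of \<sigma> bounds the argument \<open>i\<close> and is also the stage
    for \<open>b\<close>, which makes \<open>W\<close> decidable. In exchange, a computation with a
    value in \<open>B i\<close> puts only sufficiently long strings into \<open>W\<close>.\<close>
  define W where "W = {\<sigma>. \<exists>i<string_code \<sigma>. ev p (string_code \<sigma>) [i] \<noteq> 0 \<and>
    b (string_code \<sigma>) i (ev p (string_code \<sigma>) [i] - 1)}"
  have "decidable 1 (\<lambda>xs. \<not> (\<forall>i<xs ! 0. \<not> (ev p (xs ! 0) [i] \<noteq> 0 \<and> b (xs ! 0) i (ev p (xs ! 0) [i] - 1))))"
    by (intro decidable_not decidable_ball_less decidable_conj decidable_eq_0 recursive_pred
        decidable_approximation[OF ab(2)] ev1 recursive_proj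
        recursive_drop1[of 1 "\<lambda>xs. xs ! i" for i]) auto
  then have "ce {c. \<exists>i<c. ev p c [i] \<noteq> 0 \<and> b c i (ev p c [i] - 1)}"
    by (intro ce_if_decidable) simp
  also have "{c. \<exists>i<c. ev p c [i] \<noteq> 0 \<and> b c i (ev p c [i] - 1)} = string_code ` W"
    using bij_is_surj[OF bij_string_code] by (auto simp: W_def image_iff) (metis surjD)
  finally have "ce_strings W" unfolding ce_strings_def .
  then obtain \<sigma> where \<sigma>: "initial_segment \<sigma> X" "\<sigma> \<in> W \<or> (\<forall>\<tau>. prefix \<sigma> \<tau> \<longrightarrow> \<tau> \<notin> W)"
    using assms(1) unfolding one_generic_def by blast
  \<comment> \<open>By soundness the value witnessing membership in \<open>W\<close> would be
    \<open>f i\<close>, which is not in \<open>B i\<close>.\<close>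
  have "\<sigma> \<notin> W"
  proof
    assume "\<sigma> \<in> W"
    then obtain i y where y: "ev p (string_code \<sigma>) [i] = Suc y" "b (string_code \<sigma>) i y"
      by (auto simp: W_def gr0_conv_Suc)
    then have "y = f i" using runs_if_ev[OF \<sigma>(1) y(1)] p runs_deterministic by blast
    then show False using ab(4)[OF y(2)] fi by simp
  qed
  then have noW: "\<sigma> @ \<tau> \<notin> W" for \<tau> using \<sigma>(2) by auto

  have good: "y \<notin> B i" if "ev p (string_code (\<sigma> @ \<tau>)) [i] = Suc y" for i \<tau> y
  proof
    assume "y \<in> B i"
    \<comment> \<open>The restrictions of \<open>Y\<close> are the string
      \<open>\<sigma> @ \<tau>\<close> padded with false bits. The value computed with the string
      persists along them, so late ones are extensions of \<sigma> in \<open>W\<close>.\<close>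
    define Y where "Y = {k. k < length (\<sigma> @ \<tau>) \<and> (\<sigma> @ \<tau>) ! k}"
    have Y: "initial_segment (\<sigma> @ \<tau>) Y" by (simp add: initial_segment_def Y_def)
    have "\<forall>\<^sub>F m in at_top. prefix (\<sigma> @ \<tau>) (restriction Y m) \<and> restriction Y m \<in> W"
      using ev_if_runs[OF runs_if_ev[OF Y that]] ab(6)[OF \<open>y \<in> B i\<close>, of Y]
        eventually_gt_at_top[of i] eventually_ge_at_top[of "length (\<sigma> @ \<tau>)"]
    proof eventually_elim
      case (elim m)
      then have "i < string_code (restriction Y m)"
        using length_le_string_code[of "restriction Y m"] by simp
      then show ?case using elim prefix_restriction[OF Y] by (auto simp: W_def)
    qed
    then show False using noW
      by (auto simp: prefix_def eventually_at_top_linorder)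
  qed

  define \<tau> where "\<tau> = inv string_code"
  have \<tau>: "string_code (\<tau> d) = d" for d
    unfolding \<tau>_def by (rule surj_f_inv_f[OF bij_is_surj[OF bij_string_code]])
  define e where "e d i = ev p (string_code (\<sigma> @ \<tau> d)) [i]" for d i
  define Q where "Q d i \<longleftrightarrow> e d i \<noteq> 0 \<and> a (string_code (\<sigma> @ \<tau> d)) i (e d i - 1)" for d i
  \<comment> \<open>The double negation fits \<open>recursive_Least\<close>, applied to the
    decidable predicate that \<open>Q\<close> fails.\<close>
  define h where "h i = (LEAST d. \<not> \<not> Q d i)" for i
  \<comment> \<open>The search ends because long restrictions of \<open>X\<close> extend \<sigma>,
    yield \<open>f i\<close> and recognize it as a member of \<open>A i\<close>; the witness is the
    code of the part after \<sigma>.\<close>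
  have ex: "\<exists>d. \<not> \<not> Q d i" for i
  proof -
    have "\<forall>\<^sub>F m in at_top. ev p (string_code (restriction X m)) [i] = Suc (f i) \<and>
        a (string_code (restriction X m)) i (f i) \<and> length \<sigma> \<le> m"
      using ev_if_runs[OF p] ab(5)[OF fi(1)] eventually_ge_at_top by (intro eventually_conj)
    then obtain m where m: "ev p (string_code (restriction X m)) [i] = Suc (f i)"
      "a (string_code (restriction X m)) i (f i)" "length \<sigma> \<le> m"
      by (auto simp: eventually_at_top_linorder)
    then obtain \<rho> where \<rho>: "restriction X m = \<sigma> @ \<rho>" using prefix_restriction[OF \<sigma>(1)] by (auto simp: prefix_def)
    have "\<tau> (string_code \<rho>) = \<rho>" unfolding \<tau>_def by (rule inv_f_f[OF bij_is_inj[OF bij_string_code]])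
    then have "Q (string_code \<rho>) i" using m unfolding Q_def e_def \<rho> by simp
    then show ?thesis by blast
  qed
  have pad: "recursive k (\<lambda>xs. string_code (\<sigma> @ \<tau> (D xs)))" if "recursive k D" for k D
    using that by (rule recursive_string_code_append) (simp add: \<tau>)
  have "decidable (Suc 1) (\<lambda>xs. \<not> Q (xs ! 0) (drop 1 xs ! 0))"
    unfolding Q_def e_def
    by (intro decidable_not decidable_conj decidable_eq_0 recursive_pred
        decidable_approximation[OF ab(1)] ev1 pad recursive_proj
        recursive_drop1[of 1 "\<lambda>xs. xs ! i" for i]) auto
  then have "recursive 1 (\<lambda>xs. h (xs ! 0))"
    unfolding h_def using ex by (intro recursive_Least)
  then have "recursive 1 (\<lambda>xs. e (h (xs ! 0)) (xs ! 0) - 1)"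
    unfolding e_def by (intro recursive_pred ev1 pad recursive_proj) auto
  then have "computable (\<lambda>i. e (h i) i - 1)" by (rule computable_if_recursive)
  moreover have "selector (\<lambda>i. A i - B i) (\<lambda>i. e (h i) i - 1)"
    unfolding selector_def
  proof
    fix i
    have "Q (h i) i" using LeastI_ex[OF ex] unfolding h_def by simp
    then show "e (h i) i - 1 \<in> A i - B i" unfolding Q_def
      using ab(3) good[of "\<tau> (h i)" i "e (h i) i - 1"] by (auto simp: e_def)
  qed
  ultimately show thesis by (rule that)
qed

theorem theorem2:
  fixes x :: "nat set set" and A B C :: "nat \<Rightarrow> nat set"
  assumes "one_generic_degree x"
    and "uniformly_ce A" and "uniformly_ce B"
    and "\<And>i. C i = A i - B i"
  shows "((\<exists>f. degree_computable x f \<and> selector C f) \<longrightarrow>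
            (\<exists>f. computable f \<and> selector C f)) \<and>
         ((\<exists>f. degree_computable x f \<and> weak_selector A B f) \<longrightarrow>
            (\<exists>f. computable f \<and> weak_selector A B f))"
proof -
  obtain X where X: "X \<in> x" "one_generic X" "x \<in> turing_degrees"
    using assms(1) by (auto simp: one_generic_degree_def)
  \<comment> \<open>The member of the degree that computes \<open>f\<close> may differ from the
    generic member \<open>X\<close>, but it is Turing reducible to \<open>X\<close>.\<close>
  have comp: "computable_in X f" if f: "degree_computable x f" for f
  proof -
    obtain Y where Y: "Y \<in> x" "computable_in Y f" using f unfolding degree_computable_def by blast
    have "(Y, X) \<in> turing_equiv"
      using X Y quotient_eq_iff[OF equiv_turing_equiv, of x x Y X] by (simp add: turing_degrees_def)
    then show ?thesis using computable_in_trans Y(2) by (simp add: turing_equiv_def)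
  qed
  obtain a b where ab: "approximation a A" "approximation b B"
    using assms(2,3) approximation_if_uniformly_ce by metis
  have C: "C = (\<lambda>i. A i - B i)" using assms(4) by blast
  note hat = ab[THEN approximation_finite_subset_codes]
  show ?thesis
    unfolding weak_selector_def C
    by (intro conjI impI; elim exE conjE)
      (rule computable_selector[OF X(2) ab comp] computable_selector[OF X(2) hat comp]; blast)+
qed

end
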